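(* Let $d\ge2$, let $\Omega\subseteq\mathbb{R}^d$ be an open, simply connected, bounded region with $C^2$ boundary, and let $B$ be the open unit ball in $\mathbb{R}^d$. Let $A(\mathbf{s})=[a_{i,j}(\mathbf{s})]_{i,j=1}^d$ be a symmetric matrix function with entries $a_{i,j}\in C^2(\overline{\Omega})$, satisfying $\xi^{\mathrm T}A(\mathbf{s})\xi\ge c_0\,\xi^{\mathrm T}\xi$ for all $\mathbf{s}\in\overline\Omega$, $\xi\in\mathbb{R}^d$, with a constant $c_0>0$. Let $\Phi:\overline{B}\to\overline{\Omega}$ be a twice-differentiable one-to-one and onto mapping whose Jacobian matrix $J$ satisfies $\min_{\mathbf{x}\in\overline{B}}|\det J(\mathbf{x})|>0$. For $v\in C^2(\overline{\Omega})$ put $$(\mathcal{M}v)(\mathbf{s})=-\sum_{i,j=1}^d\frac{\partial}{\partial s_i}\left(a_{i,j}(\mathbf{s})\frac{\partial v(\mathbf{s})}{\partial s_j}\right),\quad \mathbf{s}\in\Omega,$$ and $\widetilde v(\mathbf{x})=v(\Phi(\mathbf{x}))$ for $\mathbf{x}\in\overline B$. Then for every $v\in C^2(\overline\Omega)$ and every $\mathbf{x}\in B$, with $\mathbf{s}=\Phi(\mathbf{x})$, $$(\mathcal{M}v)(\mathbf{s})=-\frac{1}{\det(J(\mathbf{x}))}\sum_{i,j=1}^d\frac{\partial}{\partial x_i}\left(\det(J(\mathbf{x}))\,\widetilde a_{i,j}(\mathbf{x})\frac{\partial\widetilde v(\mathbf{x})}{\partial x_j}\right),$$ where $$[\widetilde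 a_{i,j}(\mathbf{x})]_{i,j=1}^d=\widetilde A(\mathbf{x})=K(\Phi(\mathbf{x}))\,A(\Phi(\mathbf{x}))\,K(\Phi(\mathbf{x}))^{\mathrm T}.$$
   Context: Write $\Phi=(\varphi_1,\dots,\varphi_d)$. $J(\mathbf{x})=(D\Phi)(\mathbf{x})=[\partial\varphi_i(\mathbf{x})/\partial x_j]_{i,j=1}^d$ is the Jacobian matrix of $\Phi$ on $\overline B$, $\Psi=\Phi^{-1}:\overline\Omega\to\overline B$, and $K(\mathbf{s})=(D\Psi)(\mathbf{s})$ is the Jacobian matrix of $\Psi$ on $\overline\Omega$; thus $K(\Phi(\mathbf{x}))=J(\mathbf{x})^{-1}$. *)

theory Defs
  imports "HOL-Analysis.Analysis"
begin

definition partial_deriv :: "'n \<Rightarrow> (real^'n \<Rightarrow> real) \<Rightarrow> real^'n \<Rightarrow> real" where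
  "partial_deriv i f x = deriv (\<lambda>t. f (x + t *\<^sub>R axis i 1)) 0"

definition has_partial_deriv_at :: "'n \<Rightarrow> (real^'n \<Rightarrow> real) \<Rightarrow> real^'n \<Rightarrow> bool" where
  "has_partial_deriv_at i f x \<longleftrightarrow> (\<lambda>t. f (x + t *\<^sub>R axis i 1)) differentiable (at 0)"

(* C^2 up to the boundary: f is C^2 in the open set U, and f, its gradient and its Hessian
   extend continuously to the closure of U.  Only the values of g and H on U are determined as
   derivatives; on the rest of the closure they are the continuous extensions. *)
definition C2_closure :: "(real^'n) set \<Rightarrow> (real^'n \<Rightarrow> real) \<Rightarrow> bool" where
  "C2_closure U f \<longleftrightarrow>
     continuous_on (closure U) f \<and>
     (\<exists>(g :: real^'n \<Rightarrow> real^'n) (H :: real^'n \<Rightarrow> real^'n^'n).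
        continuous_on (closure U) g \<and> continuous_on (closure U) H \<and>
        (\<forall>x\<in>U. (f has_derivative (\<lambda>h. g x \<bullet> h)) (at x) \<and>
               (g has_derivative (\<lambda>h. H x *v h)) (at x)))"

(* Near each boundary point, U is the region strictly above the graph of a C^2 function in a
   rotated coordinate system: e is the vertical direction, and a function of the remaining
   d - 1 coordinates is a function on the whole space that is constant along e. *)
definition C2_boundary :: "(real^'n) set \<Rightarrow> bool" where
  "C2_boundary U \<longleftrightarrow>
     (\<forall>p\<in>frontier U. \<exists>r>0. \<exists>e \<gamma>. norm e = 1 \<and> C2_closure UNIV \<gamma> \<and>
        (\<forall>x t. \<gamma> (x + t *\<^sub>R e) = \<gamma> x) \<and>
        U \<inter> ball p r = {x \<in> ball p r. \<gamma> x < x \<bullet> e})"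

(* One-sided at the boundary of S.  On the closed unit ball the derivative within the set is
   unique, and at interior points it is the ordinary derivative. *)
definition jacobian_within :: "(real^'n) set \<Rightarrow> (real^'n \<Rightarrow> real^'n) \<Rightarrow> real^'n \<Rightarrow> real^'n^'n" where
  "jacobian_within S F x = jacobian F (at x within S)"

definition twice_differentiable_on :: "(real^'n \<Rightarrow> real^'n) \<Rightarrow> (real^'n) set \<Rightarrow> bool" where
  "twice_differentiable_on F S \<longleftrightarrow>
     F differentiable_on S \<and> jacobian_within S F differentiable_on S"

definition J :: "(real^'n \<Rightarrow> real^'n) \<Rightarrow> real^'n \<Rightarrow> real^'n^'n" where
  "J \<Phi> = jacobian_within (cball 0 1) \<Phi>"

definition K :: "(real^'n) set \<Rightarrow> (real^'n \<Rightarrow> real^'n) \<Rightarrow> real^'n \<Rightarrow> real^'n^'n" where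
  "K \<Omega> \<Phi> = jacobian_within (closure \<Omega>) (the_inv_into (cball 0 1) \<Phi>)"

definition A_tilde ::
  "(real^'n) set \<Rightarrow> (real^'n \<Rightarrow> real^'n) \<Rightarrow> (real^'n \<Rightarrow> real^'n^'n) \<Rightarrow> real^'n \<Rightarrow> real^'n^'n" where
  "A_tilde \<Omega> \<Phi> A x = K \<Omega> \<Phi> (\<Phi> x) ** A (\<Phi> x) ** transpose (K \<Omega> \<Phi> (\<Phi> x))"

definition M_op :: "(real^'n \<Rightarrow> real^'n^'n) \<Rightarrow> (real^'n \<Rightarrow> real) \<Rightarrow> real^'n \<Rightarrow> real" where
  "M_op A v s =
     - (\<Sum>i\<in>UNIV. \<Sum>j\<in>UNIV. partial_deriv i (\<lambda>s. A s $ i $ j * partial_deriv j v s) s)"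

end

theory Submission
  imports Defs
begin

text \<open>By the chain rule the flux \<open>det J * A_tilde \<nabla>(v \<circ> \<Phi>)\<close> is the cofactor matrix \<open>det J * J\<^sup>-\<^sup>1\<close>
  applied to the pulled-back flux \<open>(A \<nabla>v) \<circ> \<Phi>\<close>. The cofactor matrix has divergence-free columns
  (Piola identity), so the divergence only falls on \<open>(A \<nabla>v) \<circ> \<Phi>\<close>, where the Jacobian cancels against
  its inverse. Interior points are mapped into \<open>\<Omega>\<close> by invariance of domain, because a \<open>C\<^sup>2\<close> boundary
  leaves no interior points of the closure outside \<open>\<Omega>\<close>.\<close>

section \<open>Symmetry of the second derivative\<close>

text \<open>Only differentiability of the first derivative at the single point \<open>x\<close> is available, so the
  symmetry is obtained from the second difference quotient and the mean value theorem.\<close>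

lemma second_difference_tendsto:
  fixes f :: "'a::real_normed_vector \<Rightarrow> real"
  assumes "open S" "x \<in> S"
    and f: "\<And>y. y \<in> S \<Longrightarrow> (f has_derivative F y) (at y)"
    and F: "((\<lambda>y. F y h) has_derivative G) (at x)"
  shows "((\<lambda>t. (f (x + t *\<^sub>R h + t *\<^sub>R k) - f (x + t *\<^sub>R h) - f (x + t *\<^sub>R k) + f x) / t\<^sup>2)
           \<longlongrightarrow> G k) (at_right 0)"
proof (rule tendstoI)
  fix e :: real assume "e > 0"
  \<comment> \<open>The mean value point below involves increments of size at most
    \<open>t * norm h\<close> and \<open>t * norm h + t * norm k\<close>. \<open>C * t\<close>
    exceeds their sum, and the summand 1 makes \<open>C\<close> positive even when
    \<open>h = k = 0\<close>.\<close>
  define C where "C = 2 * norm h + norm k + 1"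
  have C: "C > 0" by (simp add: C_def add_nonneg_pos)
  interpret G: bounded_linear G using F by (rule has_derivative_bounded_linear)
  obtain r where r: "r > 0" "ball x r \<subseteq> S"
    using \<open>open S\<close> \<open>x \<in> S\<close> by (rule openE)
  \<comment> \<open>With this tolerance the two linearization errors add up to at most
    \<open>e * t / 2\<close>, strictly below \<open>e * t\<close>.\<close>
  have "e / (2 * C) > 0" using \<open>e > 0\<close> C by simp
  then obtain d where d: "d > 0"
    "\<And>y. norm (y - x) < d \<Longrightarrow> norm (F y h - F x h - G (y - x)) \<le> e / (2 * C) * norm (y - x)"
    using F unfolding has_derivative_at_alt by blast
  define D where "D = min r d / C"
  have "D > 0" using r d C by (simp add: D_def)
  have main: "dist ((f (x + t *\<^sub>R h + t *\<^sub>R k) - f (x + t *\<^sub>R h) - f (x + t *\<^sub>R k) + f x) / t\<^sup>2) (G k) < e"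
    if t: "0 < t" "t < D" for t
  proof -
    have tC: "t * C < min r d" using t C by (simp add: D_def field_simps)
    have n1: "norm (s *\<^sub>R t *\<^sub>R h) \<le> t * norm h" if "0 \<le> s" "s \<le> 1" for s
      using that t by (simp add: mult_left_le_one_le)
    have n2: "norm (s *\<^sub>R t *\<^sub>R h + t *\<^sub>R k) \<le> t * norm h + t * norm k" if "0 \<le> s" "s \<le> 1" for s
      using norm_triangle_ineq[of "s *\<^sub>R t *\<^sub>R h" "t *\<^sub>R k"] n1[OF that] t by simp
    have le: "t * norm h + t * norm k < t * C" "t * norm h < t * C"
      using t by (simp_all add: C_def algebra_simps add_pos_nonneg)
    have in1: "x + s *\<^sub>R t *\<^sub>R h \<in> S" if "0 \<le> s" "s \<le> 1" for s
      using n1[OF that] le tC r(2) by (auto simp: dist_norm subset_iff)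
    have in2: "x + s *\<^sub>R t *\<^sub>R h + t *\<^sub>R k \<in> S" if "0 \<le> s" "s \<le> 1" for s
    proof -
      have "dist x (x + s *\<^sub>R t *\<^sub>R h + t *\<^sub>R k) = norm (s *\<^sub>R t *\<^sub>R h + t *\<^sub>R k)"
        by (metis add.assoc add_diff_cancel_left' dist_commute dist_norm)
      then show ?thesis using n2[OF that] le tC r(2) by (auto simp: subset_iff)
    qed
    \<comment> \<open>The \<open>k\<close>-increment is frozen inside \<phi> and only the
      \<open>h\<close>-direction varies. The second difference is then
      \<open>\<phi> 1 - \<phi> 0\<close>, so one mean value step turns it into a first difference of
      \<open>F\<close>.\<close>
    define \<phi> where "\<phi> s = f (x + s *\<^sub>R t *\<^sub>R h + t *\<^sub>R k) - f (x + s *\<^sub>R t *\<^sub>R h)" for s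
    have "(\<phi> has_derivative (\<lambda>u. F (x + s *\<^sub>R t *\<^sub>R h + t *\<^sub>R k) (u *\<^sub>R t *\<^sub>R h)
              - F (x + s *\<^sub>R t *\<^sub>R h) (u *\<^sub>R t *\<^sub>R h))) (at s within {0..1})"
      if "0 \<le> s" "s \<le> 1" for s
    proof -
      have "((\<lambda>s. x + s *\<^sub>R t *\<^sub>R h) has_derivative (\<lambda>u. u *\<^sub>R t *\<^sub>R h)) (at s within {0..1})"
        "((\<lambda>s. x + s *\<^sub>R t *\<^sub>R h + t *\<^sub>R k) has_derivative (\<lambda>u. u *\<^sub>R t *\<^sub>R h)) (at s within {0..1})"
        by (auto intro!: derivative_eq_intros)
      from has_derivative_compose[OF this(2) f[OF in2[OF that]]]
        has_derivative_compose[OF this(1) f[OF in1[OF that]]]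
      show ?thesis unfolding \<phi>_def by (rule has_derivative_diff)
    qed
    from mvt_simple[OF zero_less_one this] obtain s where s: "s \<in> {0<..<1}"
      and "\<phi> 1 - \<phi> 0 = F (x + s *\<^sub>R t *\<^sub>R h + t *\<^sub>R k) (t *\<^sub>R h) - F (x + s *\<^sub>R t *\<^sub>R h) (t *\<^sub>R h)"
      by auto
    moreover have "F y (t *\<^sub>R h) = t * F y h" if "y \<in> S" for y
      using f[OF that] by (simp add: linear_simps(5) has_derivative_bounded_linear)
    ultimately have eq: "\<phi> 1 - \<phi> 0 = t * (F (x + s *\<^sub>R t *\<^sub>R h + t *\<^sub>R k) h - F (x + s *\<^sub>R t *\<^sub>R h) h)"
      using in1[of s] in2[of s] by (simp add: algebra_simps)
    let ?a = "s *\<^sub>R t *\<^sub>R h" and ?b = "s *\<^sub>R t *\<^sub>R h + t *\<^sub>R k"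
    have n1': "norm ?a \<le> t * norm h" and n2': "norm ?b \<le> t * norm h + t * norm k"
      using n1[of s] n2[of s] s by auto
    have est: "\<bar>F (x + z) h - F x h - G z\<bar> \<le> e / (2 * C) * b" if "norm z \<le> b" "b < t * C" for z b
    proof -
      have "norm (x + z - x) < d" using that tC by simp
      from d(2)[OF this] have "\<bar>F (x + z) h - F x h - G z\<bar> \<le> e / (2 * C) * norm z" by simp
      also have "\<dots> \<le> e / (2 * C) * b"
        using that(1) \<open>e > 0\<close> C by (intro mult_left_mono) auto
      finally show ?thesis .
    qed
    note e1 = est[OF n1' le(2)] and e2 = est[OF n2' le(1)]
    \<comment> \<open>Linearity of \<open>G\<close> removes the unknown mean value point
      \<open>s\<close> from the main term.\<close>
    have "G ?b = G ?a + t * G k" by (simp add: G.add G.scaleR)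
    with e1 e2 have "\<bar>F (x + ?b) h - F (x + ?a) h - t * G k\<bar>
        \<le> e / (2 * C) * (t * norm h) + e / (2 * C) * (t * norm h + t * norm k)"
      by linarith
    also have "\<dots> = e / (2 * C) * (t * (2 * norm h + norm k))"
      by (simp add: algebra_simps)
    also have "\<dots> \<le> e / (2 * C) * (t * C)"
      using \<open>e > 0\<close> C t by (intro mult_left_mono) (auto simp: C_def)
    also have "\<dots> < e * t" using \<open>e > 0\<close> C t by (simp add: field_simps)
    finally have b: "\<bar>F (x + ?b) h - F (x + ?a) h - t * G k\<bar> < e * t" .
    have "f (x + t *\<^sub>R h + t *\<^sub>R k) - f (x + t *\<^sub>R h) - f (x + t *\<^sub>R k) + f x = \<phi> 1 - \<phi> 0"
      by (simp add: \<phi>_def)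
    also have "\<dots> = t * (F (x + ?b) h - F (x + ?a) h)"
      using eq by (simp add: add.assoc)
    finally have "f (x + t *\<^sub>R h + t *\<^sub>R k) - f (x + t *\<^sub>R h) - f (x + t *\<^sub>R k) + f x
        = t * (F (x + ?b) h - F (x + ?a) h)" .
    moreover have "X / t\<^sup>2 - g = (Y - t * g) / t" if "X = t * Y" for X Y g
      unfolding that using t by (simp add: field_simps power2_eq_square)
    ultimately have "(f (x + t *\<^sub>R h + t *\<^sub>R k) - f (x + t *\<^sub>R h) - f (x + t *\<^sub>R k) + f x) / t\<^sup>2 - G k
        = (F (x + ?b) h - F (x + ?a) h - t * G k) / t"
      by blast
    moreover have "\<bar>Z / t\<bar> < e" if "\<bar>Z\<bar> < e * t" for Z
      using that t by (simp add: field_simps)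
    ultimately show ?thesis using b by (simp only: dist_real_def)
  qed
  show "\<forall>\<^sub>F t in at_right 0. dist ((f (x + t *\<^sub>R h + t *\<^sub>R k) - f (x + t *\<^sub>R h) - f (x + t *\<^sub>R k) + f x) / t\<^sup>2) (G k) < e"
    using main \<open>D > 0\<close> by (auto simp: eventually_at_right[OF \<open>D > 0\<close>])
qed

text \<open>The second difference is unchanged when \<open>h\<close> and \<open>k\<close> are
  exchanged, so one and the same quotient has both sides as its limit.\<close>

lemma second_derivative_symmetric:
  fixes f :: "'a::real_normed_vector \<Rightarrow> real"
  assumes "open S" "x \<in> S"
    and "\<And>y. y \<in> S \<Longrightarrow> (f has_derivative F y) (at y)"
    and "((\<lambda>y. F y h) has_derivative G) (at x)"
    and "((\<lambda>y. F y k) has_derivative G') (at x)"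
  shows "G k = G' h"
proof (rule tendsto_unique[OF trivial_limit_at_right_real])
  show "((\<lambda>t. (f (x + t *\<^sub>R h + t *\<^sub>R k) - f (x + t *\<^sub>R h) - f (x + t *\<^sub>R k) + f x) / t\<^sup>2)
           \<longlongrightarrow> G k) (at_right 0)"
    using second_difference_tendsto[OF assms(1-4)] .
  show "((\<lambda>t. (f (x + t *\<^sub>R h + t *\<^sub>R k) - f (x + t *\<^sub>R h) - f (x + t *\<^sub>R k) + f x) / t\<^sup>2)
           \<longlongrightarrow> G' h) (at_right 0)"
    using second_difference_tendsto[OF assms(1-3,5), of h]
    by (simp add: algebra_simps)
qed

section \<open>Derivatives of the determinant and of the inverse matrix\<close>

lemma has_derivative_vec_nth:
  assumes "(f has_derivative D) F"
  shows "((\<lambda>y. f y $ i) has_derivative (\<lambda>h. D h $ i)) F"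
  by (rule bounded_linear.has_derivative[OF bounded_linear_vec_nth assms])

lemma matrix_inv_unique:
  fixes A B :: "real^'n^'n"
  assumes "A ** B = mat 1"
  shows "matrix_inv A = B"
proof -
  have "A ** matrix_inv A = mat 1 \<and> matrix_inv A ** A = mat 1"
    unfolding matrix_inv_def using assms matrix_left_right_inverse by (rule_tac someI) blast
  then show ?thesis
    using assms by (metis matrix_mul_assoc matrix_mul_lid matrix_mul_rid)
qed

lemma matrix_inv_mult:
  fixes A :: "real^'n^'n"
  assumes "det A \<noteq> 0"
  shows "A ** matrix_inv A = mat 1" "matrix_inv A ** A = mat 1"
  using assms matrix_inv_unique unfolding invertible_det_nz[symmetric] invertible_def by metis+

text \<open>This is the product rule in the Leibniz formula, with the terms regrouped by the row
  whose factor is differentiated. The entrywise hypothesis also serves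
  \<open>differentiable_det\<close>.\<close>

lemma has_derivative_det_rows:
  fixes M :: "'a::real_normed_vector \<Rightarrow> real^'n^'n"
  assumes M: "\<And>p q. ((\<lambda>y. M y $ p $ q) has_derivative (\<lambda>h. D h $ p $ q)) (at x within S)"
  shows "((\<lambda>y. det (M y)) has_derivative
           (\<lambda>h. \<Sum>i\<in>UNIV. det (\<chi> p. if p = i then D h $ p else M x $ p))) (at x within S)"
proof -
  have "((\<lambda>y. det (M y)) has_derivative
      (\<lambda>h. \<Sum>\<sigma> | \<sigma> permutes UNIV. of_int (sign \<sigma>) *
        (\<Sum>i\<in>UNIV. D h $ i $ \<sigma> i * (\<Prod>j\<in>UNIV - {i}. M x $ j $ \<sigma> j)))) (at x within S)"
    unfolding det_def
    by (intro has_derivative_sum has_derivative_mult_right has_derivative_prod M)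
  moreover have "(\<Prod>k\<in>UNIV. (\<chi> p. if p = i then D h $ p else M x $ p) $ k $ \<sigma> k)
      = D h $ i $ \<sigma> i * (\<Prod>j\<in>UNIV - {i}. M x $ j $ \<sigma> j)" for h i and \<sigma> :: "'n \<Rightarrow> 'n"
    by (subst prod.remove[of _ i]) (auto intro!: prod.cong)
  then have "(\<Sum>\<sigma> | \<sigma> permutes UNIV. of_int (sign \<sigma>) *
        (\<Sum>i\<in>UNIV. D h $ i $ \<sigma> i * (\<Prod>j\<in>UNIV - {i}. M x $ j $ \<sigma> j)))
      = (\<Sum>i\<in>UNIV. det (\<chi> p. if p = i then D h $ p else M x $ p))" for h
    unfolding det_def by (simp add: sum_distrib_left) (rule sum.swap)
  ultimately show ?thesis by simp
qed

lemma differentiable_det: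
  fixes M :: "'a::real_normed_vector \<Rightarrow> real^'n^'n"
  assumes "\<And>p q. (\<lambda>y. M y $ p $ q) differentiable (at x within S)"
  shows "(\<lambda>y. det (M y)) differentiable (at x within S)"
proof (rule differentiableI[OF has_derivative_det_rows])
  show "((\<lambda>y. M y $ p $ q) has_derivative
      (\<lambda>h. (\<chi> p q. frechet_derivative (\<lambda>y. M y $ p $ q) (at x within S) h) $ p $ q)) (at x within S)" for p q
    using assms[of p q] by (simp add: frechet_derivative_works)
qed

text \<open>Since \<open>H = (H ** B) ** A\<close>, row \<open>i\<close> of \<open>H\<close> is a
  combination of the rows of \<open>A\<close> with coefficients from row \<open>i\<close> of
  \<open>H ** B\<close>. Only the multiple of row \<open>i\<close> itself survives in the
  determinant.\<close>

lemma det_replace_row: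
  fixes A B H :: "real^'n^'n"
  assumes "B ** A = mat 1"
  shows "det (\<chi> p. if p = i then H $ p else A $ p) = (H ** B) $ i $ i * det A"
proof -
  have "(\<Sum>q\<in>UNIV. (H ** B) $ i $ q *s row q A) = ((H ** B) ** A) $ i"
    by (simp add: vec_eq_iff matrix_matrix_mult_def row_def)
  also have "\<dots> = H $ i"
    by (simp add: matrix_mul_assoc[symmetric] assms)
  finally have "(\<Sum>q\<in>UNIV. (H ** B) $ i $ q *s row q A) = H $ i" .
  moreover have "row p A = A $ p" for p by (simp add: row_def)
  ultimately show ?thesis
    using cramer_lemma_transpose[of i "(H ** B) $ i" A]
    by (simp cong: if_cong)
qed

text \<open>Jacobi's formula: each replaced-row determinant contributes one diagonal entry of
  \<open>D h ** matrix_inv (M x)\<close>, and these sum to the trace.\<close>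

lemma has_derivative_det:
  fixes M :: "'a::real_normed_vector \<Rightarrow> real^'n^'n"
  assumes "(M has_derivative D) (at x within S)" "det (M x) \<noteq> 0"
  shows "((\<lambda>y. det (M y)) has_derivative (\<lambda>h. det (M x) * trace (matrix_inv (M x) ** D h)))
           (at x within S)"
  using has_derivative_det_rows[OF has_derivative_vec_nth[OF has_derivative_vec_nth[OF assms(1)]]]
  unfolding trace_mul_sym[of "matrix_inv _"]
  by (simp add: det_replace_row[OF matrix_inv_mult(2)[OF assms(2)]] trace_def sum_distrib_left
      mult.commute)

text \<open>Column \<open>l\<close> of the inverse solves a linear system with right-hand side
  \<open>axis l 1\<close>. The resulting quotient of determinants makes differentiability of the
  inverse visible.\<close>

lemma matrix_inv_cramer:
  fixes A :: "real^'n^'n"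
  assumes "det A \<noteq> 0"
  shows "matrix_inv A $ i $ l = det (\<chi> r c. if c = i then axis l 1 $ r else A $ r $ c) / det A"
proof -
  have "A *v column l (matrix_inv A) = axis l 1"
    unfolding matrix_vector_mult_basis[symmetric]
    by (simp add: matrix_vector_mul_assoc matrix_inv_mult(1)[OF assms])
  then have "column l (matrix_inv A) $ i
      = (\<chi> k. det (\<chi> i j. if j = k then axis l 1 $ i else A $ i $ j) / det A) $ i"
    by (simp only: cramer[OF assms])
  then show ?thesis by (simp add: column_def)
qed

text \<open>Cramer's rule gives existence of the derivative. Its value then follows by
  differentiating the constant product of \<open>M y\<close> with its inverse.\<close>

lemma has_derivative_matrix_inv:
  fixes M :: "'a::real_normed_vector \<Rightarrow> real^'n^'n"
  assumes M: "(M has_derivative D) (at x)" and S: "open S" "x \<in> S"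
    and nz: "\<And>y. y \<in> S \<Longrightarrow> det (M y) \<noteq> 0"
  shows "((\<lambda>y. matrix_inv (M y) $ i $ l) has_derivative
           (\<lambda>h. - ((matrix_inv (M x) ** D h ** matrix_inv (M x)) $ i $ l))) (at x)"
proof -
  let ?K = "\<lambda>y. matrix_inv (M y)"
  have d: "(\<lambda>y. M y $ p $ q) differentiable (at x)" for p q
    by (rule differentiableI[OF has_derivative_vec_nth[OF has_derivative_vec_nth[OF M]]])
  have "(\<lambda>y. ?K y $ q $ l) differentiable (at x)" for q l
  proof -
    have "(\<lambda>y. det (\<chi> r c. if c = q then axis l 1 $ r else M y $ r $ c)) differentiable (at x)"
    proof (rule differentiable_det)
      show "(\<lambda>y. (\<chi> r c. if c = q then axis l 1 $ r else M y $ r $ c) $ p $ p') differentiable (at x)"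
        for p p' using d by (cases "p' = q") simp_all
    qed
    then have "(\<lambda>y. det (\<chi> r c. if c = q then axis l 1 $ r else M y $ r $ c) / det (M y)) differentiable (at x)"
      using differentiable_det[OF d] nz[OF S(2)] by (rule differentiable_divide)
    then obtain f' where "((\<lambda>y. det (\<chi> r c. if c = q then axis l 1 $ r else M y $ r $ c) / det (M y)) has_derivative f') (at x)"
      unfolding differentiable_def by blast
    then have "((\<lambda>y. ?K y $ q $ l) has_derivative f') (at x)"
      by (rule has_derivative_transform_within_open[OF _ S]) (simp add: matrix_inv_cramer nz)
    then show ?thesis by (auto simp: differentiable_def)
  qed
  define K' where "K' q l = frechet_derivative (\<lambda>y. ?K y $ q $ l) (at x)" for q l
  have K': "((\<lambda>y. ?K y $ q $ l) has_derivative K' q l) (at x)" for q l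
    unfolding K'_def frechet_derivative_works[symmetric] by fact
  have "(\<Sum>q\<in>UNIV. M x $ p $ q * K' q l h + D h $ p $ q * ?K x $ q $ l) = 0" for p l h
  proof -
    have "((\<lambda>y. \<Sum>q\<in>UNIV. M y $ p $ q * ?K y $ q $ l) has_derivative
        (\<lambda>h. \<Sum>q\<in>UNIV. M x $ p $ q * K' q l h + D h $ p $ q * ?K x $ q $ l)) (at x)"
      by (intro has_derivative_sum has_derivative_mult has_derivative_vec_nth M K')
    moreover have "((\<lambda>y. \<Sum>q\<in>UNIV. M y $ p $ q * ?K y $ q $ l) has_derivative (\<lambda>h. 0)) (at x)"
    proof (rule has_derivative_transform_within_open[OF has_derivative_const S])
      fix y assume "y \<in> S"
      then have "(M y ** ?K y) $ p $ l = mat 1 $ p $ l"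
        using matrix_inv_mult(1)[OF nz] by simp
      then show "mat 1 $ p $ l = (\<Sum>q\<in>UNIV. M y $ p $ q * ?K y $ q $ l)"
        by (simp add: matrix_matrix_mult_def)
    qed
    ultimately show ?thesis by (rule has_derivative_unique[THEN fun_cong])
  qed
  then have "M x ** (\<chi> q l. K' q l h) + D h ** ?K x = 0" for h
    by (simp add: vec_eq_iff matrix_matrix_mult_def sum.distrib)
  then have eq: "M x ** (\<chi> q l. K' q l h) = - (D h ** ?K x)" for h
    by (simp add: eq_neg_iff_add_eq_0)
  have neg: "P ** (- Q) = - (P ** Q)" for P Q :: "real^'n^'n"
    by (simp add: vec_eq_iff matrix_matrix_mult_def sum_negf)
  have "(\<chi> q l. K' q l h) = ?K x ** (M x ** (\<chi> q l. K' q l h))" for h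
    by (simp add: matrix_mul_assoc matrix_inv_mult(2)[OF nz[OF S(2)]])
  then have "(\<chi> q l. K' q l h) = - (?K x ** D h ** ?K x)" for h
    unfolding eq by (simp add: neg matrix_mul_assoc)
  then have "K' i l = (\<lambda>h. - ((?K x ** D h ** ?K x) $ i $ l))"
    by (simp add: vec_eq_iff fun_eq_iff)
  then show ?thesis using K'[of i l] by simp
qed

text \<open>The Piola identity: for a Jacobian matrix \<open>M\<close>, the columns of \<open>det M *\<^sub>R M\<^sup>-\<^sup>1\<close> are
  divergence free. Both terms of the derivative below contract to the same sum, by symmetry of the
  second derivatives.\<close>

lemma has_derivative_det_mult_matrix_inv:
  fixes M :: "'a::real_normed_vector \<Rightarrow> real^'n^'n"
  assumes M: "(M has_derivative D) (at x)" and S: "open S" "x \<in> S"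
    and nz: "\<And>y. y \<in> S \<Longrightarrow> det (M y) \<noteq> 0"
  shows "((\<lambda>y. det (M y) * matrix_inv (M y) $ i $ l) has_derivative
           (\<lambda>h. det (M x) * (trace (matrix_inv (M x) ** D h) * matrix_inv (M x) $ i $ l
                  - (matrix_inv (M x) ** D h ** matrix_inv (M x)) $ i $ l))) (at x)"
  by (rule has_derivative_eq_rhs[OF has_derivative_mult[OF has_derivative_det[OF M nz[OF S(2)]]
        has_derivative_matrix_inv[OF M S nz]]]) (auto simp: algebra_simps)

text \<open>In the application \<open>H i\<close> is the derivative of a Jacobian in direction
  \<open>i\<close>, so the hypothesis says that mixed second partials of component \<open>p\<close>
  agree. Exchanging the names of \<open>i\<close> and \<open>q\<close> then matches the two
  sums.\<close>

lemma piola_contraction: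
  fixes B :: "real^'n^'n" and H :: "'n \<Rightarrow> real^'n^'n"
  assumes "\<And>i p q. H i $ p $ q = H q $ p $ i"
  shows "(\<Sum>i\<in>UNIV. trace (B ** H i) * B $ i $ l - (B ** H i ** B) $ i $ l) = 0"
proof -
  have "(\<Sum>i\<in>UNIV. (B ** H i ** B) $ i $ l)
      = (\<Sum>i\<in>UNIV. \<Sum>q\<in>UNIV. (\<Sum>p\<in>UNIV. B $ i $ p * H i $ p $ q) * B $ q $ l)"
    by (simp add: matrix_matrix_mult_def)
  also have "\<dots> = (\<Sum>q\<in>UNIV. \<Sum>i\<in>UNIV. (\<Sum>p\<in>UNIV. B $ i $ p * H q $ p $ i) * B $ q $ l)"
    by (subst sum.swap) (simp only: assms)
  also have "\<dots> = (\<Sum>q\<in>UNIV. trace (B ** H q) * B $ q $ l)"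
    by (simp add: trace_def matrix_matrix_mult_def sum_distrib_right)
  finally show ?thesis by (simp add: sum_subtractf)
qed

section \<open>Change of variables in the elliptic operator\<close>

lemma has_derivative_imp_partial_deriv:
  assumes "(f has_derivative f') (at x)"
  shows "partial_deriv i f x = f' (axis i 1)" "has_partial_deriv_at i f x"
proof -
  have "((\<lambda>t. x + t *\<^sub>R axis i 1) has_derivative (\<lambda>t. t *\<^sub>R axis i 1)) (at (0::real))"
    by (auto intro!: derivative_eq_intros)
  moreover have "(f has_derivative f') (at (x + 0 *\<^sub>R axis i 1))" using assms by simp
  ultimately have "((\<lambda>t. f (x + t *\<^sub>R axis i 1)) has_derivative (\<lambda>t. f' (t *\<^sub>R axis i 1))) (at 0)"
    by (rule has_derivative_compose)
  then have D: "((\<lambda>t. f (x + t *\<^sub>R axis i 1)) has_real_derivative f' (axis i 1)) (at 0)"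
    using assms unfolding has_field_derivative_def
    by (simp add: linear_simps(5) has_derivative_bounded_linear mult.commute[of _ "f' (axis i 1)"])
  show "partial_deriv i f x = f' (axis i 1)"
    unfolding partial_deriv_def by (rule DERIV_imp_deriv[OF D])
  show "has_partial_deriv_at i f x"
    unfolding has_partial_deriv_at_def by (rule differentiableI[OF D[unfolded has_field_derivative_def]])
qed

text \<open>Near a frontier point, \<open>U\<close> lies on only one side of a graph. An interior
  point of the closure would have closure points strictly on the other side as well, and hence
  points of \<open>U\<close> there.\<close>

lemma C2_boundary_interior_closure:
  assumes "open U" "C2_boundary U"
  shows "interior (closure U) \<subseteq> U"
proof
  fix p assume p: "p \<in> interior (closure U)"
  show "p \<in> U"
  proof (rule ccontr)
    assume "p \<notin> U"
    with p \<open>open U\<close> have "p \<in> frontier U"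
      using interior_subset by (auto simp: frontier_def interior_open)
    from bspec[OF \<open>C2_boundary U\<close>[unfolded C2_boundary_def] this] obtain r e \<gamma> where r: "r > 0" and e: "norm e = 1"
      and \<gamma>: "C2_closure UNIV \<gamma>" "\<And>x t. \<gamma> (x + t *\<^sub>R e) = \<gamma> x"
      and U: "U \<inter> ball p r = {x \<in> ball p r. \<gamma> x < x \<bullet> e}"
      by (elim exE conjE) (rule that, auto)
    have cont: "continuous_on UNIV \<gamma>" using \<gamma>(1) by (simp add: C2_closure_def)
    obtain d where d: "d > 0" "ball p d \<subseteq> closure U"
      using p unfolding mem_interior by blast
    define t where "t = min r d / 2"
    have t: "0 < t" "t < r" "t < d" using r d by (auto simp: t_def)
    \<comment> \<open>Moving down from \<open>p\<close> along \<open>e\<close> leaves \<gamma>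
      unchanged and lowers the height by \<open>t\<close>. As \<open>p\<close> is on or below the
      graph, \<open>z\<close> is strictly below it, yet still in the closure of
      \<open>U\<close>.\<close>
    define z where "z = p + (- t) *\<^sub>R e"
    have "dist p z = t" using t e by (simp add: z_def dist_norm)
    then have z: "z \<in> ball p r" "z \<in> closure U" using t d(2) by auto
    have "p \<bullet> e \<le> \<gamma> p"
    proof (rule ccontr)
      assume "\<not> p \<bullet> e \<le> \<gamma> p"
      then have "p \<in> U \<inter> ball p r" using r unfolding U by simp
      with \<open>p \<notin> U\<close> show False by simp
    qed
    moreover have "e \<bullet> e = 1" using e by (simp add: dot_square_norm)
    ultimately have "z \<bullet> e < \<gamma> z"
      unfolding z_def \<gamma>(2) using t by (simp add: inner_diff_left)
    moreover have "open {x. x \<bullet> e < \<gamma> x}"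
      by (intro open_Collect_less continuous_intros cont)
    ultimately obtain w where "w \<in> U" "w \<in> ball p r" "w \<bullet> e < \<gamma> w"
      using z open_Int_closure_eq_empty[of "ball p r \<inter> {x. x \<bullet> e < \<gamma> x}" U] by blast
    moreover from this(1,2) have "w \<in> {x \<in> ball p r. \<gamma> x < x \<bullet> e}"
      unfolding U[symmetric] by blast
    ultimately show False by auto
  qed
qed

lemma has_derivative_J:
  assumes "\<Phi> differentiable_on cball 0 1" "y \<in> ball 0 1"
  shows "(\<Phi> has_derivative (\<lambda>h. J \<Phi> y *v h)) (at y)"
proof -
  have "at y within cball 0 1 = at y"
    using assms(2) by (intro at_within_interior) simp
  moreover have "\<Phi> differentiable (at y within cball 0 1)"
    using assms by (auto simp: differentiable_on_def)
  ultimately show ?thesis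
    unfolding J_def jacobian_within_def by (metis jacobian_works)
qed

text \<open>Differentiating the inverse map needs its continuity at the image point, which comes
  from compactness of the closed ball. At a point of the open set \<Omega> the derivative within the
  closure is the ordinary one.\<close>

lemma K_eq_matrix_inv_J:
  assumes "open \<Omega>" and bij: "bij_betw \<Phi> (cball 0 1) (closure \<Omega>)"
    and diff: "\<Phi> differentiable_on cball 0 1"
    and y: "y \<in> ball 0 1" "\<Phi> y \<in> \<Omega>" and nz: "det (J \<Phi> y) \<noteq> 0"
  shows "K \<Omega> \<Phi> (\<Phi> y) = matrix_inv (J \<Phi> y)"
proof -
  let ?\<Psi> = "the_inv_into (cball 0 1) \<Phi>"
  have inj: "inj_on \<Phi> (cball 0 1)" and img: "\<Phi> ` cball 0 1 = closure \<Omega>"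
    using bij by (auto simp: bij_betw_def)
  have "continuous_on (\<Phi> ` cball 0 1) ?\<Psi>"
    by (rule continuous_on_inv[OF differentiable_imp_continuous_on[OF diff]])
      (auto simp: the_inv_into_f_f[OF inj])
  then have "continuous_on \<Omega> ?\<Psi>"
    unfolding img by (rule continuous_on_subset[OF _ closure_subset])
  then have cont: "isCont ?\<Psi> (\<Phi> y)"
    using \<open>open \<Omega>\<close> y(2) by (simp add: continuous_on_eq_continuous_at)
  have "(?\<Psi> has_derivative (\<lambda>h. matrix_inv (J \<Phi> y) *v h)) (at (\<Phi> y))"
  proof (rule has_derivative_inverse_basic_x[OF has_derivative_J[OF diff y(1)] _ _ cont _ \<open>open \<Omega>\<close> y(2)])
    show "bounded_linear ((*v) (matrix_inv (J \<Phi> y)))" by (rule matrix_vector_mul_bounded_linear)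
    show "(*v) (matrix_inv (J \<Phi> y)) \<circ> (*v) (J \<Phi> y) = id"
      by (simp add: fun_eq_iff matrix_vector_mul_assoc matrix_inv_mult(2)[OF nz])
    show "?\<Psi> (\<Phi> y) = y" using y(1) by (intro the_inv_into_f_f[OF inj]) simp
    show "\<Phi> (?\<Psi> z) = z" if "z \<in> \<Omega>" for z
      using that img closure_subset by (intro f_the_inv_into_f[OF inj]) blast
  qed
  then have "frechet_derivative ?\<Psi> (at (\<Phi> y)) = (\<lambda>h. matrix_inv (J \<Phi> y) *v h)"
    by (rule frechet_derivative_at[symmetric])
  moreover have "at (\<Phi> y) within closure \<Omega> = at (\<Phi> y)"
    using y(2) \<open>open \<Omega>\<close> by (intro at_within_interior) (meson closure_subset interiorI)
  ultimately show ?thesis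
    by (simp add: K_def jacobian_within_def jacobian_def)
qed

text \<open>\<open>deriv\<close> has a value even where no derivative exists. The first three
  conjuncts therefore record that the image point lies in \<Omega> and that the partial derivatives
  on the right-hand side exist.\<close>

theorem theorem3:
  fixes \<Omega> :: "(real^'n) set"
    and A :: "real^'n \<Rightarrow> real^'n^'n"
    and \<Phi> :: "real^'n \<Rightarrow> real^'n"
    and c\<^sub>0 :: real
    and v :: "real^'n \<Rightarrow> real"
    and x :: "real^'n"
  assumes "CARD('n) \<ge> 2"
    and "open \<Omega>" and "simply_connected \<Omega>" and "bounded \<Omega>" and "C2_boundary \<Omega>"
    and "\<forall>s\<in>closure \<Omega>. transpose (A s) = A s"
    and "\<forall>i j. C2_closure \<Omega> (\<lambda>s. A s $ i $ j)"
    and "c\<^sub>0 > 0" and "\<forall>s\<in>closure \<Omega>. \<forall>\<xi>. \<xi> \<bullet> (A s *v \<xi>) \<ge> c\<^sub>0 * (\<xi> \<bullet> \<xi>)"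
    and "bij_betw \<Phi> (cball 0 1) (closure \<Omega>)"
    and "twice_differentiable_on \<Phi> (cball 0 1)"
    and "(INF y\<in>cball 0 1. \<bar>det (J \<Phi> y)\<bar>) > 0"
    and "C2_closure \<Omega> v"
    and "x \<in> ball 0 1"
  shows "\<Phi> x \<in> \<Omega>
    \<and> (\<forall>j. has_partial_deriv_at j (v \<circ> \<Phi>) x)
    \<and> (\<forall>i j. has_partial_deriv_at i
           (\<lambda>y. det (J \<Phi> y) * A_tilde \<Omega> \<Phi> A y $ i $ j * partial_deriv j (v \<circ> \<Phi>) y) x)
    \<and> M_op A v (\<Phi> x) = - (1 / det (J \<Phi> x)) *
         (\<Sum>i\<in>UNIV. \<Sum>j\<in>UNIV. partial_deriv i
           (\<lambda>y. det (J \<Phi> y) * A_tilde \<Omega> \<Phi> A y $ i $ j * partial_deriv j (v \<circ> \<Phi>) y) x)"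
proof -

  \<comment> \<open>Interior points and the inverse Jacobian\<close>
  note open_Om = \<open>open \<Omega>\<close>
  have diff: "\<Phi> differentiable_on cball 0 1" and diff_J: "J \<Phi> differentiable_on cball 0 1"
    using \<open>twice_differentiable_on \<Phi> (cball 0 1)\<close> by (auto simp: twice_differentiable_on_def J_def)
  have inj: "inj_on \<Phi> (cball 0 1)" and img: "\<Phi> ` cball 0 1 = closure \<Omega>"
    using \<open>bij_betw \<Phi> (cball 0 1) (closure \<Omega>)\<close> by (auto simp: bij_betw_def)
  have ball: "open (ball 0 (1::real) :: (real^'n) set)" "x \<in> ball 0 1"
    using \<open>x \<in> ball 0 1\<close> by auto
  have nz: "det (J \<Phi> y) \<noteq> 0" if "y \<in> ball 0 1" for y
  proof -
    have "(INF y\<in>cball 0 1. \<bar>det (J \<Phi> y)\<bar>) \<le> \<bar>det (J \<Phi> y)\<bar>"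
      using that by (intro cINF_lower bdd_belowI[of _ 0]) auto
    then show ?thesis using \<open>(INF y\<in>cball 0 1. \<bar>det (J \<Phi> y)\<bar>) > 0\<close> by linarith
  qed
  have "open (\<Phi> ` ball 0 1)"
    using continuous_on_subset[OF differentiable_imp_continuous_on[OF diff]] inj_on_subset[OF inj]
    by (intro invariance_of_domain) auto
  moreover have "\<Phi> ` ball 0 1 \<subseteq> closure \<Omega>"
    using img by (metis ball_subset_cball image_mono)
  ultimately have "\<Phi> ` ball 0 1 \<subseteq> interior (closure \<Omega>)" by (rule interior_maximal[rotated])
  then have in_Om: "\<Phi> y \<in> \<Omega>" if "y \<in> ball 0 1" for y
    using C2_boundary_interior_closure[OF open_Om \<open>C2_boundary \<Omega>\<close>] that by blast
  note dPhi = has_derivative_J[OF diff]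
  note K_eq = K_eq_matrix_inv_J[OF open_Om \<open>bij_betw \<Phi> (cball 0 1) (closure \<Omega>)\<close> diff _ in_Om nz]
  define B where "B y = matrix_inv (J \<Phi> y)" for y
  have JB: "J \<Phi> y ** B y = mat 1" if "y \<in> ball 0 1" for y
    unfolding B_def by (rule matrix_inv_mult(1)[OF nz[OF that]])

  \<comment> \<open>Second derivatives of \<Phi>\<close>
  obtain D where dJ: "(J \<Phi> has_derivative D) (at x)"
  proof -
    have "at x within cball 0 1 = at x"
      using ball(2) by (intro at_within_interior) simp
    moreover have "J \<Phi> differentiable (at x within cball 0 1)"
      using diff_J ball(2) by (auto simp: differentiable_on_def)
    ultimately show ?thesis using that by (auto simp: differentiable_def)
  qed
  have sym: "D (axis i 1) $ p $ q = D (axis q 1) $ p $ i" for i p q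
  proof -
    \<comment> \<open>\<open>D h $ p $ r\<close> is the derivative of the \<open>r\<close>-th
      partial of component \<open>p\<close>, so \<open>sym\<close> is equality of mixed partials for
      that component.\<close>
    have der: "((\<lambda>y. (J \<Phi> y *v axis r 1) $ p) has_derivative (\<lambda>h. D h $ p $ r)) (at x)" for r
      unfolding matrix_vector_mult_basis column_def vec_lambda_beta
      by (intro has_derivative_vec_nth dJ)
    show ?thesis
      by (rule second_derivative_symmetric[OF ball has_derivative_vec_nth[OF dPhi] der der])
  qed

  \<comment> \<open>The flux in the original coordinates\<close>
  obtain g H where g: "\<And>s. s \<in> \<Omega> \<Longrightarrow> (v has_derivative (\<lambda>h. g s \<bullet> h)) (at s)"
    and H: "\<And>s. s \<in> \<Omega> \<Longrightarrow> (g has_derivative (\<lambda>h. H s *v h)) (at s)"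
    using \<open>C2_closure \<Omega> v\<close> unfolding C2_closure_def by blast
  have dA: "(\<lambda>s. A s $ i $ j) differentiable (at (\<Phi> x))" for i j
  proof -
    obtain a where "((\<lambda>s. A s $ i $ j) has_derivative (\<lambda>h. a (\<Phi> x) \<bullet> h)) (at (\<Phi> x))"
      using \<open>\<forall>i j. C2_closure \<Omega> (\<lambda>s. A s $ i $ j)\<close> in_Om[OF ball(2)] unfolding C2_closure_def by meson
    then show ?thesis by (rule differentiableI)
  qed
  have dg: "(\<lambda>s. g s $ j) differentiable (at (\<Phi> x))" for j
    by (rule differentiableI[OF has_derivative_vec_nth[OF H[OF in_Om[OF ball(2)]]]])
  have pd_v: "partial_deriv j v s = g s $ j" if "s \<in> \<Omega>" for j s
    using has_derivative_imp_partial_deriv(1)[OF g[OF that]] by (simp add: inner_axis)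

  define F where "F l s = (\<Sum>j\<in>UNIV. A s $ l $ j * g s $ j)" for l s
  \<comment> \<open>\<open>M_op\<close> differentiates each product separately, so the derivative of
    the flux component \<open>F l\<close> is kept as a sum of the pieces
    \<open>F' l j\<close>.\<close>
  define F' where "F' l j = frechet_derivative (\<lambda>s. A s $ l $ j * g s $ j) (at (\<Phi> x))" for l j
  have F'j: "((\<lambda>s. A s $ l $ j * g s $ j) has_derivative F' l j) (at (\<Phi> x))" for l j
    unfolding F'_def frechet_derivative_works[symmetric] by (intro differentiable_mult dA dg)
  have dF: "(F l has_derivative (\<lambda>h. \<Sum>j\<in>UNIV. F' l j h)) (at (\<Phi> x))" for l
    unfolding F_def by (intro has_derivative_sum F'j)
  have dFv: "((\<lambda>s. A s $ i $ j * partial_deriv j v s) has_derivative F' i j) (at (\<Phi> x))" for i j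
    by (rule has_derivative_transform_within_open[OF F'j open_Om in_Om[OF ball(2)]])
      (simp add: pd_v)
  have M_op: "M_op A v (\<Phi> x) = - (\<Sum>l\<in>UNIV. \<Sum>j\<in>UNIV. F' l j (axis l 1))"
    unfolding M_op_def has_derivative_imp_partial_deriv(1)[OF dFv] ..

  \<comment> \<open>The flux in the ball\<close>
  have dv: "((v \<circ> \<Phi>) has_derivative (\<lambda>h. g (\<Phi> y) \<bullet> (J \<Phi> y *v h))) (at y)" if "y \<in> ball 0 1" for y
    unfolding o_def by (rule has_derivative_compose[OF dPhi[OF that] g[OF in_Om[OF that]]])
  have pd_vt: "partial_deriv j (v \<circ> \<Phi>) y = (transpose (J \<Phi> y) *v g (\<Phi> y)) $ j"
    if "y \<in> ball 0 1" for j y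
    unfolding has_derivative_imp_partial_deriv(1)[OF dv[OF that]] matrix_vector_mult_basis
    by (simp add: inner_vec_def column_def matrix_vector_mult_def transpose_def mult.commute)

  \<comment> \<open>\<open>T\<close> has explicitly differentiable factors: \<open>B\<close> stands
    for \<open>K\<close> and the transposed Jacobian times \<open>g\<close> for the gradient of the
    composition. It agrees with the original expression on the open ball, which suffices for
    derivatives at \<open>x\<close>.\<close>
  define T where "T i j y = det (J \<Phi> y) * (B y ** A (\<Phi> y) ** transpose (B y)) $ i $ j
      * (transpose (J \<Phi> y) *v g (\<Phi> y)) $ j" for i j y
  have T_eq: "det (J \<Phi> y) * A_tilde \<Omega> \<Phi> A y $ i $ j * partial_deriv j (v \<circ> \<Phi>) y = T i j y"
    if "y \<in> ball 0 1" for i j y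
    using that by (simp add: T_def A_tilde_def pd_vt K_eq B_def)
  have diff_T: "T i j differentiable (at x)" for i j
  proof -
    have J: "(\<lambda>y. J \<Phi> y $ p $ q) differentiable (at x)" for p q
      by (rule differentiableI[OF has_derivative_vec_nth[OF has_derivative_vec_nth[OF dJ]]])
    have B: "(\<lambda>y. B y $ p $ q) differentiable (at x)" for p q
      unfolding B_def by (rule differentiableI[OF has_derivative_matrix_inv[OF dJ ball nz]])
    have \<Phi>: "\<Phi> differentiable (at x)"
      by (rule differentiableI[OF dPhi[OF ball(2)]])
    have A: "(\<lambda>y. A (\<Phi> y) $ p $ q) differentiable (at x)" for p q
      using differentiable_chain_at[OF \<Phi> dA[of p q]] by (simp add: o_def)
    have G: "(\<lambda>y. g (\<Phi> y) $ p) differentiable (at x)" for p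
      using differentiable_chain_at[OF \<Phi> dg[of p]] by (simp add: o_def)
    show ?thesis
      unfolding T_def[abs_def] matrix_matrix_mult_def transpose_def matrix_vector_mult_def vec_lambda_beta
      by (intro differentiable_mult differentiable_sum differentiable_det J B A G ballI) auto
  qed
  define T' where "T' i j = frechet_derivative (T i j) (at x)" for i j
  have dT: "(T i j has_derivative T' i j) (at x)" for i j
    unfolding T'_def frechet_derivative_works[symmetric] by (rule diff_T)
  have dT2: "((\<lambda>y. det (J \<Phi> y) * A_tilde \<Omega> \<Phi> A y $ i $ j * partial_deriv j (v \<circ> \<Phi>) y)
      has_derivative T' i j) (at x)" for i j
    by (rule has_derivative_transform_within_open[OF dT ball]) (simp add: T_eq)

  \<comment> \<open>Divergence of the transformed flux\<close>
  define N where "N i l y = det (J \<Phi> y) * B y $ i $ l" for i l y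
  define N' where "N' i l h = det (J \<Phi> x) * (trace (B x ** D h) * B x $ i $ l
      - (B x ** D h ** B x) $ i $ l)" for i l h
  have dN: "(N i l has_derivative N' i l) (at x)" for i l
    unfolding N_def[abs_def] N'_def[abs_def] B_def
    by (rule has_derivative_det_mult_matrix_inv[OF dJ ball nz])
  have div_N: "(\<Sum>i\<in>UNIV. N' i l (axis i 1)) = 0" for l
    unfolding N'_def sum_distrib_left[symmetric]
    using piola_contraction[of "\<lambda>i. D (axis i 1)" "B x" l] sym by simp
  have flux: "(\<Sum>j\<in>UNIV. T i j y) = (\<Sum>l\<in>UNIV. N i l y * F l (\<Phi> y))" if "y \<in> ball 0 1" for i y
  proof -
    have BJ: "transpose (B y) ** transpose (J \<Phi> y) = mat 1"
      by (simp add: matrix_transpose_mul[symmetric] JB[OF that])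
    have "(B y ** A (\<Phi> y) ** transpose (B y)) *v (transpose (J \<Phi> y) *v g (\<Phi> y))
        = (B y ** A (\<Phi> y) ** (transpose (B y) ** transpose (J \<Phi> y))) *v g (\<Phi> y)"
      by (simp only: matrix_vector_mul_assoc matrix_mul_assoc)
    also have "\<dots> = B y *v (A (\<Phi> y) *v g (\<Phi> y))"
      by (simp only: BJ matrix_mul_rid matrix_vector_mul_assoc)
    finally have "(B y ** A (\<Phi> y) ** transpose (B y)) *v (transpose (J \<Phi> y) *v g (\<Phi> y))
        = B y *v (A (\<Phi> y) *v g (\<Phi> y))" .
    moreover have "(\<Sum>j\<in>UNIV. T i j y) = det (J \<Phi> y)
        * ((B y ** A (\<Phi> y) ** transpose (B y)) *v (transpose (J \<Phi> y) *v g (\<Phi> y))) $ i"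
      unfolding T_def matrix_vector_mult_def[of "B y ** A (\<Phi> y) ** transpose (B y)"]
      by (simp add: sum_distrib_left mult.assoc)
    ultimately show ?thesis
      by (simp add: matrix_vector_mult_def N_def F_def sum_distrib_left mult.assoc)
  qed
  \<comment> \<open>The two sides are derivatives of the two expressions for the same function in
    \<open>flux\<close>, so uniqueness of the derivative equates them.\<close>
  have div_T: "(\<Sum>j\<in>UNIV. T' i j h) = (\<Sum>l\<in>UNIV. N i l x * (\<Sum>j\<in>UNIV. F' l j (J \<Phi> x *v h))
      + N' i l h * F l (\<Phi> x))" for i h
  proof -
    have "((\<lambda>y. \<Sum>l\<in>UNIV. N i l y * F l (\<Phi> y)) has_derivative
        (\<lambda>h. \<Sum>l\<in>UNIV. N i l x * (\<Sum>j\<in>UNIV. F' l j (J \<Phi> x *v h)) + N' i l h * F l (\<Phi> x))) (at x)"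
      by (intro has_derivative_sum has_derivative_mult dN
          has_derivative_compose[OF dPhi[OF ball(2)] dF])
    then have "((\<lambda>y. \<Sum>j\<in>UNIV. T i j y) has_derivative
        (\<lambda>h. \<Sum>l\<in>UNIV. N i l x * (\<Sum>j\<in>UNIV. F' l j (J \<Phi> x *v h)) + N' i l h * F l (\<Phi> x))) (at x)"
      by (rule has_derivative_transform_within_open[OF _ ball]) (simp add: flux)
    moreover have "((\<lambda>y. \<Sum>j\<in>UNIV. T i j y) has_derivative (\<lambda>h. \<Sum>j\<in>UNIV. T' i j h)) (at x)"
      by (intro has_derivative_sum dT)
    ultimately show ?thesis by (rule has_derivative_unique[THEN fun_cong, symmetric])
  qed
  have main: "(\<Sum>i\<in>UNIV. N i l x * (\<Sum>j\<in>UNIV. F' l j (J \<Phi> x *v axis i 1)))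
      = det (J \<Phi> x) * (\<Sum>j\<in>UNIV. F' l j (axis l 1))" for l
  proof -
    define L where "L h = (\<Sum>j\<in>UNIV. F' l j h)" for h
    have L: "linear L"
      using has_derivative_linear[OF dF[of l]] by (simp add: L_def[abs_def])
    \<comment> \<open>By linearity of \<open>L\<close>, the Jacobian can be contracted with
      \<open>N\<close> before \<open>L\<close> is applied. The contraction is column
      \<open>l\<close> of \<open>det J\<close> times \<open>J ** B\<close>, and
      \<open>J ** B\<close> is the identity.\<close>
    have "(\<Sum>i\<in>UNIV. N i l x *\<^sub>R (J \<Phi> x *v axis i 1)) = det (J \<Phi> x) *\<^sub>R axis l 1"
    proof (subst vec_eq_iff, rule allI)
      fix m
      have "(\<Sum>i\<in>UNIV. N i l x *\<^sub>R (J \<Phi> x *v axis i 1)) $ m = det (J \<Phi> x) * (J \<Phi> x ** B x) $ m $ l"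
        by (simp add: matrix_vector_mult_basis column_def N_def matrix_matrix_mult_def
            sum_distrib_left mult_ac)
      then show "(\<Sum>i\<in>UNIV. N i l x *\<^sub>R (J \<Phi> x *v axis i 1)) $ m = (det (J \<Phi> x) *\<^sub>R axis l 1) $ m"
        by (simp add: JB[OF ball(2)] mat_def axis_def)
    qed
    then have "L (\<Sum>i\<in>UNIV. N i l x *\<^sub>R (J \<Phi> x *v axis i 1)) = L (det (J \<Phi> x) *\<^sub>R axis l 1)"
      by simp
    then show ?thesis
      unfolding linear_sum[OF L] linear_scale[OF L] by (simp add: L_def)
  qed
  have "(\<Sum>i\<in>UNIV. \<Sum>j\<in>UNIV. T' i j (axis i 1))
      = (\<Sum>l\<in>UNIV. \<Sum>i\<in>UNIV. N i l x * (\<Sum>j\<in>UNIV. F' l j (J \<Phi> x *v axis i 1))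
          + N' i l (axis i 1) * F l (\<Phi> x))"
    unfolding div_T by (rule sum.swap)
  \<comment> \<open>After the exchange of sums, \<open>F l\<close> no longer depends on the inner
    index and factors out of the \<open>N'\<close> terms, which vanish by
    \<open>div_N\<close>.\<close>
  also have "\<dots> = (\<Sum>l\<in>UNIV. det (J \<Phi> x) * (\<Sum>j\<in>UNIV. F' l j (axis l 1)))"
    by (simp only: sum.distrib main sum_distrib_right[symmetric] div_N) simp
  also have "\<dots> = - det (J \<Phi> x) * M_op A v (\<Phi> x)"
    unfolding M_op sum_distrib_left[symmetric] by simp
  finally have "M_op A v (\<Phi> x)
      = - (1 / det (J \<Phi> x)) * (\<Sum>i\<in>UNIV. \<Sum>j\<in>UNIV. T' i j (axis i 1))"
    using nz[OF ball(2)] by simp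
  then show ?thesis
    using in_Om[OF ball(2)] has_derivative_imp_partial_deriv(2)[OF dv[OF ball(2)]]
      has_derivative_imp_partial_deriv(2)[OF dT2]
    by (simp only: has_derivative_imp_partial_deriv(1)[OF dT2]) blast
qed

end
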